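(* Let $a$ be a constant nonzero semisimple $2\times2$ matrix and let $U=(u_{ij})_{i,j\in\mathbb{Z}}$ be a matrix of $2\times2$ blocks $u_{ij}$ depending on $t_{\pm1},t_{\pm2},\ldots$ that satisfies $$\frac{\partial U}{\partial t_{\pm k}}=(a\otimes\Lambda^{\pm k})U-U(a\otimes\Lambda^{\mp k})-U(a\otimes\mathcal{O}_{\pm k})U,\qquad k=1,2,\ldots,$$ together with the constraint $$(E_2\otimes\Lambda)U-U(E_2\otimes\Lambda^{-1})-U(E_2\otimes\mathcal{O}_1)U=0.$$ Let $$u_0(z)=\Bigl(E_2-\sum_{j=0}^\infty u_{0j}z^{-j-1}\Bigr)\rho(z),\qquad \bar u_0(z)=\Bigl(E_2+\sum_{j=0}^\infty u_{0,-j-1}z^{j}\Bigr)\rho(z),\qquad \rho(z)=\exp\Bigl(\sum_{k=1}^\infty a(t_kz^k+t_{-k}z^{-k})\Bigr).$$ Then for every $k\ge1$ there are $A_k(z)$ and $\bar A_k(z)$ such that $$\frac{\partial u_0(z)}{\partial t_k}=A_k(z)u_0(z),\quad \frac{\partial\bar u_0(z)}{\partial t_k}=A_k(z)\bar u_0(z),\quad \frac{\partial u_0(z)}{\partial t_{-k}}=\bar A_k(z)u_0(z),\quad \frac{\partial\bar u_0(z)}{\partial t_{-k}}=\bar A_k(z)\bar u_0(z),$$ where $$A_k(z)=az^k+a_{k1}z^{k-1}+\cdots+a_{kk},\qquad \bar A_k(z)=\bar a_{k,0}z^{-k}+\cdots+\bar a_{k,k-1}z^{-1}$$ are polynomials in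 $z$ and $z^{-1}$, respectively, with $2\times2$ matrix coefficients (functions of the $t_{\pm k}$'s independent of $z$).
   Context: $E_{ij}$ denotes the scalar $\mathbb{Z}\times\mathbb{Z}$ matrix unit and $E_2$ the $2\times2$ unit matrix. $\Lambda^k=\sum_{i\in\mathbb{Z}}E_{i,i+k}$ ($k\in\mathbb{Z}$); for $k\ge1$, $\mathcal{O}_k=\sum_{i=0}^{k-1}E_{i,k-i-1}$ and $\mathcal{O}_{-k}=-\sum_{l=1}^kE_{-l,l-k-1}$. For a $2\times2$ matrix $A$ and a scalar $\mathbb{Z}\times\mathbb{Z}$ matrix $B=(b_{ij})$, $(A\otimes B)U=\bigl(\sum_kb_{ik}Au_{kj}\bigr)_{ij}$ and $U(A\otimes B)=\bigl(\sum_ku_{ik}Ab_{kj}\bigr)_{ij}$. The wave functions are formal Laurent series in $z$ with $2\times2$ matrix coefficients times the right factor $\rho(z)$, with $\partial\rho(z)/\partial t_{\pm k}=z^{\pm k}a\rho(z)$. *)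

theory Defs
  imports "HOL-Analysis.Analysis" "HOL-Library.Groups_Big_Fun"
begin

type_synonym mat2 = "complex ^ 2 ^ 2"

(* t k is the time t_k for k \<noteq> 0; the value t 0 plays no role. *)
type_synonym times = "int \<Rightarrow> complex"

text \<open>An endomorphism is semisimple iff every invariant subspace has an invariant complement
  (over the complex numbers: iff it is diagonalizable).\<close>

definition invariant_subspace :: "mat2 \<Rightarrow> (complex ^ 2) set \<Rightarrow> bool" where
  "invariant_subspace A V \<longleftrightarrow> vec.subspace V \<and> (\<forall>v\<in>V. A *v v \<in> V)"

definition semisimple_mat :: "mat2 \<Rightarrow> bool" where
  "semisimple_mat A \<longleftrightarrow>
     (\<forall>V. invariant_subspace A V \<longrightarrow>
        (\<exists>V'. invariant_subspace A V' \<and> V \<inter> V' = {0} \<and> {v + v' | v v'. v \<in> V \<and> v' \<in> V'} = UNIV))"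


section \<open>Infinite matrices\<close>

type_synonym smat = "int \<Rightarrow> int \<Rightarrow> complex"
type_synonym bmat = "int \<Rightarrow> int \<Rightarrow> mat2"

definition Eunit :: "int \<Rightarrow> int \<Rightarrow> smat" where
  "Eunit i j = (\<lambda>p q. if p = i \<and> q = j then 1 else 0)"

definition Lambda :: "int \<Rightarrow> smat" where
  "Lambda k = (\<lambda>p q. Sum_any (\<lambda>i. Eunit i (i + k) p q))"

(* For negative k = -m the l-th summand E_{-l, l-m-1} of O_{-m} reads Eunit (- l) (l + k - 1). *)
definition Omat :: "int \<Rightarrow> smat" where
  "Omat k = (\<lambda>p q.
     if k > 0 then (\<Sum>i = 0..k - 1. Eunit i (k - i - 1) p q)
     else - (\<Sum>l = 1..- k. Eunit (- l) (l + k - 1) p q))"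

(* mat c is the scalar matrix c E_2, so the (i,j) block is b_ij A. *)
definition tensor :: "mat2 \<Rightarrow> smat \<Rightarrow> bmat"  (infixr "\<otimes>\<^sub>m" 75) where
  "A \<otimes>\<^sub>m B = (\<lambda>i j. mat (B i j) ** A)"

text \<open>Each entry is a sum over all integers. It is only meaningful if that sum has finitely many
  nonzero terms, which holds whenever one factor is built from \<open>Lambda\<close> or \<open>Omat\<close>.\<close>

definition bmult :: "bmat \<Rightarrow> bmat \<Rightarrow> bmat"  (infixl "\<odot>" 70) where
  "X \<odot> Y = (\<lambda>i j. Sum_any (\<lambda>k. X i k ** Y k j))"


section \<open>Partial derivatives\<close>

text \<open>Domains that contain, around each of their points, an open piece of every coordinate line,
  so that partial derivatives of functions on the domain make sense.\<close>

definition times_domain :: "times set \<Rightarrow> bool" where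
  "times_domain D \<longleftrightarrow> (\<forall>t\<in>D. \<forall>k. k \<noteq> 0 \<longrightarrow> (\<forall>\<^sub>F s in nhds (t k). t(k := s) \<in> D))"

definition has_partial :: "(times \<Rightarrow> mat2) \<Rightarrow> mat2 \<Rightarrow> int \<Rightarrow> times \<Rightarrow> bool" where
  "has_partial f f' k t \<longleftrightarrow>
     (\<forall>i j. ((\<lambda>s. f (t(k := s)) $ i $ j) has_field_derivative f' $ i $ j) (at (t k)))"


section \<open>Formal wave functions\<close>

(* Coefficient sequences: F stands for the formal series \<Sum>n. F n z^n, n \<in> \<int>. *)
type_synonym series = "int \<Rightarrow> mat2"

definition zmon :: "mat2 \<Rightarrow> int \<Rightarrow> series" where
  "zmon C p = (\<lambda>n. if n = p then C else 0)"

(* Only meaningful if the sums are finite; in use, one factor is always a Laurent polynomial. *)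
definition series_mult :: "series \<Rightarrow> series \<Rightarrow> series"  (infixl "\<star>" 70) where
  "F \<star> G = (\<lambda>n. Sum_any (\<lambda>m. F m ** G (n - m)))"

definition series_has_partial :: "(times \<Rightarrow> series) \<Rightarrow> series \<Rightarrow> int \<Rightarrow> times \<Rightarrow> bool" where
  "series_has_partial F F' k t \<longleftrightarrow> (\<forall>n. has_partial (\<lambda>s. F s n) (F' n) k t)"

text \<open>\<open>Wave W \<theta>\<close> is the formal product \<open>W(z) exp(\<theta>(z))\<close>. The product is not multiplied out
  (its coefficients would be infinite sums); the exponential is a formal right factor, known
  through its derivatives only.\<close>

datatype wave = Wave (amplitude: series) (phase: series)

definition wave_lmult :: "series \<Rightarrow> wave \<Rightarrow> wave" where
  "wave_lmult A w = Wave (A \<star> amplitude w) (phase w)"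

text \<open>The product rule \<open>\<partial>(W e\<^sup>\<theta>) = (\<partial>W + W \<partial>\<theta>) e\<^sup>\<theta>\<close>, adequate for phases whose coefficients
  commute with those of their derivatives, as is the case for \<open>rho_phase\<close> below.\<close>

definition wave_has_partial :: "(times \<Rightarrow> wave) \<Rightarrow> wave \<Rightarrow> int \<Rightarrow> times \<Rightarrow> bool" where
  "wave_has_partial w w' k t \<longleftrightarrow>
     (\<exists>W' \<theta>'. series_has_partial (\<lambda>s. amplitude (w s)) W' k t \<and>
              series_has_partial (\<lambda>s. phase (w s)) \<theta>' k t \<and>
              w' = Wave (\<lambda>n. W' n + (amplitude (w t) \<star> \<theta>') n) (phase (w t)))"

(* \<Sum>k\<ge>1. a (t_k z^k + t_{-k} z^{-k}) *)
definition rho_phase :: "mat2 \<Rightarrow> times \<Rightarrow> series" where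
  "rho_phase a t = (\<lambda>n. if n = 0 then 0 else mat (t n) ** a)"

definition rho :: "mat2 \<Rightarrow> times \<Rightarrow> wave" where
  "rho a t = Wave (zmon (mat 1) 0) (rho_phase a t)"

text \<open>The defining property \<open>\<partial>\<rho>(z)/\<partial>t\<^sub>k = z\<^sup>k a \<rho>(z)\<close>, for \<open>k\<close> of either sign.\<close>

lemma rho_has_partial:
  assumes "k \<noteq> 0"
  shows "wave_has_partial (rho a) (wave_lmult (zmon a k) (rho a t)) k t"
proof -
  have mat_entry: "(mat c ** a) $ i $ j = c * a $ i $ j" for c and i j :: 2
    using exhaust_2[of i] by (auto simp: mat_def matrix_matrix_mult_def sum_2)
  have single: "Sum_any (\<lambda>m. if m = p then c else 0) = c" for p :: int and c :: mat2
    by (subst Sum_any.expand_superset[of "{p}"]) auto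
  have W: "series_has_partial (\<lambda>s. amplitude (rho a s)) (\<lambda>n. 0) k t"
    by (simp add: rho_def series_has_partial_def has_partial_def)
  have T: "series_has_partial (\<lambda>s. phase (rho a s)) (zmon a k) k t"
    unfolding series_has_partial_def has_partial_def
  proof (intro allI)
    fix n i j
    show "((\<lambda>s. phase (rho a (t(k := s))) n $ i $ j) has_field_derivative zmon a k n $ i $ j)
        (at (t k))"
      using assms
      by (cases "n = k"; cases "n = 0")
        (auto simp: rho_def rho_phase_def zmon_def mat_entry intro!: derivative_eq_intros)
  qed
  have "zmon a k \<star> zmon (mat 1) 0 = zmon a k"
  proof
    fix n
    have "(\<lambda>m. zmon a k m ** zmon (mat 1) 0 (n - m)) = (\<lambda>m. if m = n then zmon a k n else 0)"
      by (auto simp: zmon_def fun_eq_iff)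
    then show "(zmon a k \<star> zmon (mat 1) 0) n = zmon a k n"
      by (simp only: series_mult_def single)
  qed
  moreover have "zmon (mat 1) 0 \<star> zmon a k = zmon a k"
  proof
    fix n
    have "(\<lambda>m. zmon (mat 1) 0 m ** zmon a k (n - m)) = (\<lambda>m. if m = 0 then zmon a k n else 0)"
      by (auto simp: zmon_def fun_eq_iff)
    then show "(zmon (mat 1) 0 \<star> zmon a k) n = zmon a k n"
      by (simp only: series_mult_def single)
  qed
  ultimately show ?thesis
    unfolding wave_has_partial_def
    by (intro exI[of _ "\<lambda>n. 0"] exI[of _ "zmon a k"] conjI W T) (simp add: wave_lmult_def rho_def)
qed

definition u0 :: "mat2 \<Rightarrow> (times \<Rightarrow> bmat) \<Rightarrow> times \<Rightarrow> wave" where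
  "u0 a U t = wave_lmult
     (\<lambda>n. zmon (mat 1) 0 n - Sum_any (\<lambda>j::nat. zmon (U t 0 (int j)) (- int j - 1) n)) (rho a t)"

definition u0bar :: "mat2 \<Rightarrow> (times \<Rightarrow> bmat) \<Rightarrow> times \<Rightarrow> wave" where
  "u0bar a U t = wave_lmult
     (\<lambda>n. zmon (mat 1) 0 n + Sum_any (\<lambda>j::nat. zmon (U t 0 (- int j - 1)) (int j) n)) (rho a t)"

end

theory Submission
  imports Defs
begin

text \<open>For a constant \<open>c\<close> let \<open>row c u i\<close> be the formal series
  \<open>z\<^sup>i + \<Sum>\<^sub>n (c + [n \<ge> 0]) u\<^bsub>i,-n-1\<^esub> z\<^sup>n\<close>. The amplitudes of \<open>u\<^sub>0(z)\<close> and of its barred version are the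
  rows \<open>i = 0\<close> for \<open>c = -1\<close> and \<open>c = 0\<close>. For every \<open>c\<close> the constraint becomes the recursion
  \<open>row (i+1) = z row i + u\<^bsub>i,0\<^esub> row 0\<close>, so that \<open>row i = P\<^sub>i(z) row 0\<close> with a Laurent polynomial
  \<open>P\<^sub>i\<close> which does not depend on \<open>c\<close>; it is monic of degree \<open>i\<close> if \<open>i \<ge> 0\<close>, and a polynomial in
  \<open>z\<^sup>-\<^sup>1\<close> without constant term if \<open>i < 0\<close>. The evolution equations express the derivatives of
  \<open>row 0 \<cdot> \<rho>\<close> linearly through the rows with coefficients independent of \<open>c\<close>.\<close>

section \<open>Entries of the infinite matrix products\<close>

text \<open>The coefficient of \<open>Omat k\<close> on its antidiagonal; it is also the jump
  \<open>[n \<ge> 0] - [n \<ge> k]\<close> of a shifted step function.\<close>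

definition antidiag_weight :: "int \<Rightarrow> int \<Rightarrow> real" where
  "antidiag_weight k n = of_bool (0 \<le> n) - of_bool (k \<le> n)"

text \<open>Contains every index of nonzero weight for either sign: \<open>0..k-1\<close> if
  \<open>k > 0\<close> and \<open>k..-1\<close> if \<open>k < 0\<close>, so the two families of
  \<open>Omat\<close> need no separate treatment.\<close>

definition antidiag_range :: "int \<Rightarrow> int set" where
  "antidiag_range k = {min 0 k..<max 0 k}"

lemma finite_antidiag_range [simp]: "finite (antidiag_range k)"
  by (simp add: antidiag_range_def)

lemma antidiag_weight_outside: "n \<notin> antidiag_range k \<Longrightarrow> antidiag_weight k n = 0"
  by (auto simp: antidiag_range_def antidiag_weight_def)

text \<open>Lets the antidiagonal of \<open>Omat k\<close> be indexed by its column as well as by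
  its row.\<close>

lemma antidiag_weight_reflect: "antidiag_weight k (k - 1 - n) = antidiag_weight k n"
  by (auto simp: antidiag_weight_def)

lemma Sum_any_single:
  assumes "\<And>x. x \<noteq> p \<Longrightarrow> f x = 0"
  shows "Sum_any f = f p"
  using assms by (subst Sum_any.expand_superset[of "{p}"]) auto

lemma Lambda_entry: "Lambda k p q = (if q = p + k then 1 else 0)"
  unfolding Lambda_def by (subst Sum_any_single[of p]) (auto simp: Eunit_def)

lemma Omat_entry: "Omat k p q = (if q = k - 1 - p then of_real (antidiag_weight k p) else 0)"
proof (cases "k > 0")
  case True
  have "(\<Sum>i = 0..k - 1. Eunit i (k - i - 1) p q)
      = (\<Sum>i = 0..k - 1. if i = p then (if q = k - 1 - p then 1 else 0) else 0)"
    by (intro sum.cong) (auto simp: Eunit_def)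
  then show ?thesis
    using True by (auto simp: Omat_def antidiag_weight_def)
next
  case False
  have "(\<Sum>l = 1..- k. Eunit (- l) (l + k - 1) p q)
      = (\<Sum>l = 1..- k. if l = - p then (if q = k - 1 - p then 1 else 0) else 0)"
    by (intro sum.cong) (auto simp: Eunit_def)
  then show ?thesis
    using False by (auto simp: Omat_def antidiag_weight_def)
qed

lemma mat_of_real_mult: "mat (of_real r) ** (A :: mat2) = r *\<^sub>R A"
  by (auto simp: vec_eq_iff mat_def matrix_matrix_mult_def sum_2 forall_2)
    (simp_all add: scaleR_conv_of_real)

lemma tensor_Lambda_entry: "(A \<otimes>\<^sub>m Lambda k) i j = (if j = i + k then A else 0)"
  by (simp add: tensor_def Lambda_entry matrix_mul_lid)

lemma tensor_Omat_entry:
  "(A \<otimes>\<^sub>m Omat k) i j = (if j = k - 1 - i then antidiag_weight k i *\<^sub>R A else 0)"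
  by (simp add: tensor_def Omat_entry mat_of_real_mult)

lemma tensor_Lambda_bmult: "((A \<otimes>\<^sub>m Lambda k) \<odot> u) i j = A ** u (i + k) j"
  unfolding bmult_def by (subst Sum_any_single[of "i + k"]) (auto simp: tensor_Lambda_entry)

lemma bmult_tensor_Lambda: "(u \<odot> (A \<otimes>\<^sub>m Lambda k)) i j = u i (j - k) ** A"
  unfolding bmult_def by (subst Sum_any_single[of "j - k"]) (auto simp: tensor_Lambda_entry)

lemma bmult_tensor_Omat:
  "(u \<odot> (A \<otimes>\<^sub>m Omat k)) i q = antidiag_weight k q *\<^sub>R (u i (k - 1 - q) ** A)"
  unfolding bmult_def
  by (subst Sum_any_single[of "k - 1 - q"])
    (auto simp: tensor_Omat_entry antidiag_weight_reflect matrix_scalar_ac scalar_matrix_assoc[symmetric])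

lemma bmult_tensor_Omat_bmult:
  "(u \<odot> (A \<otimes>\<^sub>m Omat k) \<odot> u) i j
     = (\<Sum>q\<in>antidiag_range k. antidiag_weight k q *\<^sub>R (u i (k - 1 - q) ** A ** u q j))"
proof -
  have "(u \<odot> (A \<otimes>\<^sub>m Omat k) \<odot> u) i j
      = Sum_any (\<lambda>q. antidiag_weight k q *\<^sub>R (u i (k - 1 - q) ** A ** u q j))"
    by (subst bmult_def) (simp add: bmult_tensor_Omat scalar_matrix_assoc[symmetric])
  also have "\<dots> = (\<Sum>q\<in>antidiag_range k. antidiag_weight k q *\<^sub>R (u i (k - 1 - q) ** A ** u q j))"
    using antidiag_weight_outside by (intro Sum_any.expand_superset) auto
  finally show ?thesis .
qed


section \<open>Multiplication of series by Laurent polynomials\<close>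

text \<open>\<open>Sum_any\<close> is 0 on infinite support, so a finite set carrying the left
  factor is what makes the product meaningful; \<open>G\<close> may extend infinitely in both
  directions.\<close>

lemma series_mult_finite:
  assumes "finite S" "\<And>m. m \<notin> S \<Longrightarrow> F m = 0"
  shows "(F \<star> G) n = (\<Sum>m\<in>S. F m ** G (n - m))"
  unfolding series_mult_def using assms by (intro Sum_any.expand_superset) force+

lemma zmon_series_mult: "(zmon C p \<star> G) n = C ** G (n - p)"
  by (subst series_mult_finite[of "{p}"]) (auto simp: zmon_def)

lemma series_mult_zmon: "(F \<star> zmon C p) n = F (n - p) ** C"
  unfolding series_mult_def by (subst Sum_any_single[of "n - p"]) (auto simp: zmon_def)

lemma series_mult_shift:
  assumes "finite {m. F m \<noteq> 0}"
  shows "((\<lambda>m. F (m - p)) \<star> G) n = (F \<star> G) (n - p)"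
proof -
  have "((\<lambda>m. F (m - p)) \<star> G) n = (\<Sum>m\<in>(\<lambda>m. m + p) ` {m. F m \<noteq> 0}. F (m - p) ** G (n - m))"
    using assms by (intro series_mult_finite) (auto simp: image_iff dest: spec[of _ "_ - p"])
  also have "\<dots> = (\<Sum>m\<in>{m. F m \<noteq> 0}. F m ** G (n - p - m))"
    by (subst sum.reindex) (auto simp: inj_on_def algebra_simps)
  also have "\<dots> = (F \<star> G) (n - p)"
    using assms by (intro series_mult_finite[symmetric]) auto
  finally show ?thesis .
qed

lemma matrix_add_rdistrib: "(A + B) ** C = A ** C + (B ** C :: mat2)"
  by (simp add: vec_eq_iff matrix_matrix_mult_def sum.distrib algebra_simps)

lemma series_mult_add_left:
  assumes "finite {m. F m \<noteq> 0}" "finite {m. H m \<noteq> 0}"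
  shows "((\<lambda>m. F m + H m) \<star> G) n = (F \<star> G) n + (H \<star> G) n"
proof -
  let ?S = "{m. F m \<noteq> 0} \<union> {m. H m \<noteq> 0}"
  have "((\<lambda>m. F m + H m) \<star> G) n = (\<Sum>m\<in>?S. (F m + H m) ** G (n - m))"
    using assms by (intro series_mult_finite) auto
  also have "\<dots> = (\<Sum>m\<in>?S. F m ** G (n - m)) + (\<Sum>m\<in>?S. H m ** G (n - m))"
    by (simp add: matrix_add_rdistrib sum.distrib)
  also have "(\<Sum>m\<in>?S. F m ** G (n - m)) = (F \<star> G) n"
    using assms by (intro series_mult_finite[symmetric]) auto
  also have "(\<Sum>m\<in>?S. H m ** G (n - m)) = (H \<star> G) n"
    using assms by (intro series_mult_finite[symmetric]) auto
  finally show ?thesis .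
qed

lemma matrix_sum_distrib_left: "(C :: mat2) ** sum f S = (\<Sum>x\<in>S. C ** f x)"
  by (induction S rule: infinite_finite_induct) (simp_all add: matrix_add_ldistrib)

lemma series_mult_const_left:
  assumes "finite {m. F m \<noteq> 0}"
  shows "((\<lambda>m. C ** F m) \<star> G) n = C ** (F \<star> G) n"
proof -
  have "((\<lambda>m. C ** F m) \<star> G) n = (\<Sum>m\<in>{m. F m \<noteq> 0}. C ** F m ** G (n - m))"
    using assms by (intro series_mult_finite) auto
  also have "\<dots> = C ** (F \<star> G) n"
    using assms by (subst series_mult_finite[of "{m. F m \<noteq> 0}" F])
      (auto simp: matrix_sum_distrib_left matrix_mul_assoc)
  finally show ?thesis .
qed

lemma finite_support_sum:
  assumes "finite Q" "\<And>q. q \<in> Q \<Longrightarrow> finite {m. F q m \<noteq> (0 :: mat2)}"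
  shows "finite {m. (\<Sum>q\<in>Q. F q m) \<noteq> 0}"
proof (rule finite_subset)
  show "{m. (\<Sum>q\<in>Q. F q m) \<noteq> 0} \<subseteq> (\<Union>q\<in>Q. {m. F q m \<noteq> 0})"
    using sum.not_neutral_contains_not_neutral by blast
qed (use assms in blast)

lemma series_mult_sum_left:
  assumes "finite Q" "\<And>q. q \<in> Q \<Longrightarrow> finite {m. F q m \<noteq> 0}"
  shows "((\<lambda>m. \<Sum>q\<in>Q. F q m) \<star> G) n = (\<Sum>q\<in>Q. (F q \<star> G) n)"
  using assms
proof (induction Q rule: finite_induct)
  case empty
  show ?case by (simp add: series_mult_finite[of "{}"])
next
  case (insert q Q)
  then show ?case
    using finite_support_sum[of Q F] by (simp add: series_mult_add_left)
qed


section \<open>Rows as Laurent polynomial multiples of the zeroth row\<close>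

definition row :: "real \<Rightarrow> bmat \<Rightarrow> int \<Rightarrow> series" where
  "row c u i n = zmon (mat 1) i n + (c + of_bool (0 \<le> n)) *\<^sub>R u i (- n - 1)"

text \<open>With \<open>j = - n - 1\<close>, the term \<open>u i (j + 1)\<close> belongs to the
  power \<open>n - 1\<close>, but it carries the cutoff of \<open>n\<close>. The two cutoffs differ
  only at \<open>n = 0\<close>, and this excess \<open>u i 0\<close> is exactly the monomial of
  \<open>row c u 0\<close> multiplied by \<open>u i 0\<close>.\<close>

lemma row_Suc:
  assumes "\<And>i j. u (i + 1) j = u i (j + 1) + u i 0 ** u 0 j"
  shows "row c u (i + 1) n = row c u i (n - 1) + u i 0 ** row c u 0 n"
  using assms[of i "- n - 1"]
  by (auto simp: row_def zmon_def matrix_add_ldistrib matrix_scalar_ac scalar_matrix_assoc[symmetric]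
      scaleR_add_left scaleR_add_right)

text \<open>The last two clauses later yield the leading coefficient \<open>a\<close> for positive
  times and the missing constant term for negative ones.\<close>

definition row_factor :: "bmat \<Rightarrow> int \<Rightarrow> series \<Rightarrow> bool" where
  "row_factor u i P \<longleftrightarrow>
     (\<forall>c. row c u i = P \<star> row c u 0) \<and> (\<forall>n. P n \<noteq> 0 \<longrightarrow> min 0 i \<le> n \<and> n \<le> max 0 i) \<and>
     (i \<ge> 0 \<longrightarrow> P i = mat 1) \<and> (i < 0 \<longrightarrow> P 0 = 0)"

lemma row_factor_finite: "row_factor u i P \<Longrightarrow> finite {n. P n \<noteq> 0}"
  by (rule finite_subset[of _ "{min 0 i..max 0 i}"]) (auto simp: row_factor_def)

lemma finite_zmon: "finite {n. zmon C p n \<noteq> 0}"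
  by (rule finite_subset[of _ "{p}"]) (auto simp: zmon_def)

lemma finite_shift:
  fixes P :: series
  assumes "finite {n. P n \<noteq> 0}"
  shows "finite {n. P (n - p) \<noteq> 0}"
  by (rule finite_subset[OF _ finite_imageI[OF assms, of "\<lambda>n. n + p"]])
    (auto simp: image_iff, metis diff_add_cancel)

text \<open>The recursion for the rows can be run in both directions from \<open>row 0\<close>,
  where the factor is 1.\<close>

lemma row_factor_exists:
  assumes u: "\<And>i j. u (i + 1) j = u i (j + 1) + u i 0 ** u 0 j"
  shows "\<exists>P. row_factor u i P"
proof (induction i rule: int_induct[of _ 0])
  case base
  have "row_factor u 0 (zmon (mat 1) 0)"
    by (auto simp: row_factor_def zmon_series_mult fun_eq_iff) (auto simp: zmon_def split: if_splits)
  then show ?case by blast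
next
  case (step1 i)
  then obtain P where P: "row_factor u i P" by blast
  \<comment> \<open>This is \<open>z P + u i 0\<close>, read off from
    \<open>row_Suc\<close>.\<close>
  let ?P = "\<lambda>n. P (n - 1) + zmon (u i 0) 0 n"
  have "row c u (i + 1) = ?P \<star> row c u 0" for c
    using P row_factor_finite[OF P]
    by (auto simp: fun_eq_iff row_Suc[OF u] series_mult_add_left finite_shift finite_zmon
        series_mult_shift zmon_series_mult row_factor_def)
  moreover have "min 0 (i + 1) \<le> n \<and> n \<le> max 0 (i + 1)" if "?P n \<noteq> 0" for n
  proof (cases "n = 0")
    case False
    with that P have "min 0 i \<le> n - 1 \<and> n - 1 \<le> max 0 i"
      by (auto simp: zmon_def row_factor_def)
    with step1 show ?thesis by auto
  qed (use step1 in auto)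
  moreover have "?P (i + 1) = mat 1"
    using P step1 by (auto simp: row_factor_def zmon_def)
  ultimately have "row_factor u (i + 1) ?P"
    using step1 by (auto simp: row_factor_def)
  then show ?case by blast
next
  case (step2 i)
  then obtain P where P: "row_factor u i P" by blast
  \<comment> \<open>The recursion from \<open>i - 1\<close> to \<open>i\<close>, solved for the
    lower row: \<open>(P - u (i - 1) 0) / z\<close>. Writing \<open>n - (- 1)\<close> fits the form
    of \<open>series_mult_shift\<close>.\<close>
  let ?P = "\<lambda>n. P (n - (- 1)) + zmon (- u (i - 1) 0) (- 1) n"
  have neg: "(- A) ** B = - (A ** B)" for A B :: mat2
    using matrix_add_rdistrib[of A "- A" B] by (simp add: eq_neg_iff_add_eq_0 add.commute)
  have "row c u (i - 1) = ?P \<star> row c u 0" for c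
  proof
    fix n
    have "row c u (i - 1) n = row c u i (n + 1) - u (i - 1) 0 ** row c u 0 (n + 1)"
      using row_Suc[OF u, of c "i - 1" "n + 1"] by simp
    also have "\<dots> = (P \<star> row c u 0) (n - (- 1)) + (- u (i - 1) 0) ** row c u 0 (n - (- 1))"
      using P by (simp add: row_factor_def neg)
    also have "\<dots> = (?P \<star> row c u 0) n"
      by (simp only: series_mult_add_left finite_shift finite_zmon row_factor_finite[OF P]
          series_mult_shift zmon_series_mult)
    finally show "row c u (i - 1) n = (?P \<star> row c u 0) n" .
  qed
  \<comment> \<open>As \<open>i \<le> 0\<close>, \<open>P\<close> has no positive powers, so
    division by \<open>z\<close> leaves only negative ones.\<close>
  moreover have "min 0 (i - 1) \<le> n \<and> n \<le> max 0 (i - 1) \<and> n \<noteq> 0" if "?P n \<noteq> 0" for n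
  proof (cases "n = - 1")
    case False
    with that P have "min 0 i \<le> n + 1 \<and> n + 1 \<le> max 0 i"
      by (auto simp: zmon_def row_factor_def)
    with step2 show ?thesis by auto
  qed (use step2 in auto)
  ultimately have "row_factor u (i - 1) ?P"
    using step2 unfolding row_factor_def by fastforce
  then show ?case by blast
qed


section \<open>Derivatives of the wave functions\<close>

lemma wave_eq_row:
  shows u0_eq_row: "u0 a U t = Wave (row (- 1) (U t) 0) (rho_phase a t)"
    and u0bar_eq_row: "u0bar a U t = Wave (row 0 (U t) 0) (rho_phase a t)"
proof -
  have "Sum_any (\<lambda>j::nat. zmon (U t 0 (int j)) (- int j - 1) n)
      = of_bool (n < 0) *\<^sub>R U t 0 (- n - 1)" for n
    \<comment> \<open>For \<open>n \<ge> 0\<close> the index defaults to 0; its monomial has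
      exponent -1 and contributes nothing at \<open>n\<close>.\<close>
    by (subst Sum_any_single[of "nat (- n - 1)"]) (auto simp: zmon_def)
  then show "u0 a U t = Wave (row (- 1) (U t) 0) (rho_phase a t)"
    by (auto simp: u0_def wave_lmult_def rho_def fun_eq_iff series_mult_zmon row_def)
  have "Sum_any (\<lambda>j::nat. zmon (U t 0 (- int j - 1)) (int j) n)
      = of_bool (0 \<le> n) *\<^sub>R U t 0 (- n - 1)" for n
    by (subst Sum_any_single[of "nat n"]) (auto simp: zmon_def)
  then show "u0bar a U t = Wave (row 0 (U t) 0) (rho_phase a t)"
    by (auto simp: u0bar_def wave_lmult_def rho_def fun_eq_iff series_mult_zmon row_def)
qed

lemma rho_phase_has_partial:
  assumes "k \<noteq> 0"
  shows "series_has_partial (rho_phase a) (zmon a k) k t"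
  unfolding series_has_partial_def has_partial_def
proof (intro allI)
  fix n and i j :: 2
  have entry: "(mat c ** a) $ i $ j = c * a $ i $ j" for c
    using exhaust_2[of i] by (auto simp: mat_def matrix_matrix_mult_def sum_2)
  show "((\<lambda>s. rho_phase a (t(k := s)) n $ i $ j) has_field_derivative zmon a k n $ i $ j) (at (t k))"
    using assms by (cases "n = k"; cases "n = 0")
      (auto simp: rho_phase_def zmon_def entry intro!: derivative_eq_intros)
qed

lemma has_partial_affine:
  assumes "has_partial f f' k t"
  shows "has_partial (\<lambda>s. C + r *\<^sub>R f s) (r *\<^sub>R f') k t"
  using assms unfolding has_partial_def
  by (auto simp: scaleR_conv_of_real intro!: derivative_eq_intros)

text \<open>Differentiating the phase adds \<open>row 0\<close> times \<open>a z^k\<close>. Its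
  monomial completes \<open>U t k\<close> to a row; its shifted cutoff differs from the original one
  by \<open>antidiag_weight k\<close>, which supplies the monomials \<open>z^q\<close> completing
  each \<open>U t q\<close> in the quadratic term.\<close>

lemma wave_has_partial_row:
  assumes "k \<noteq> 0"
    and evolution: "\<And>j. has_partial (\<lambda>s. U s 0 j)
      (a ** U t k j - U t 0 (j + k) ** a
        - (\<Sum>q\<in>antidiag_range k. antidiag_weight k q *\<^sub>R (U t 0 (k - 1 - q) ** a ** U t q j))) k t"
  shows "wave_has_partial (\<lambda>s. Wave (row c (U s) 0) (rho_phase a s))
    (Wave (\<lambda>n. a ** row c (U t) k n
        - (\<Sum>q\<in>antidiag_range k. antidiag_weight k q *\<^sub>R (U t 0 (k - 1 - q) ** a ** row c (U t) q n)))
      (rho_phase a t)) k t"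
proof -
  let ?h = "\<lambda>n. c + of_bool (0 \<le> n) :: real"
  let ?R = "antidiag_range k" and ?\<omega> = "antidiag_weight k" and ?v = "U t 0"
  define W' where "W' n = ?h n *\<^sub>R (a ** U t k (- n - 1) - ?v (k - 1 - n) ** a
      - (\<Sum>q\<in>?R. ?\<omega> q *\<^sub>R (?v (k - 1 - q) ** a ** U t q (- n - 1))))" for n
  have "series_has_partial (\<lambda>s. row c (U s) 0) W' k t"
    unfolding series_has_partial_def
  proof
    fix n
    have "- n - 1 + k = k - 1 - n" by simp
    with has_partial_affine[OF evolution[of "- n - 1"], of "zmon (mat 1) 0 n" "?h n"]
    show "has_partial (\<lambda>s. row c (U s) 0 n) (W' n) k t"
      by (simp add: row_def W'_def)
  qed
  moreover have "a ** row c (U t) k n - (\<Sum>q\<in>?R. ?\<omega> q *\<^sub>R (?v (k - 1 - q) ** a ** row c (U t) q n))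
      = W' n + (row c (U t) 0 \<star> zmon a k) n" for n
  proof -
    have "(\<Sum>q\<in>?R. ?\<omega> q *\<^sub>R (?v (k - 1 - q) ** a ** row c (U t) q n))
      = (\<Sum>q\<in>?R. ?\<omega> q *\<^sub>R (?v (k - 1 - q) ** a ** zmon (mat 1) q n))
        + ?h n *\<^sub>R (\<Sum>q\<in>?R. ?\<omega> q *\<^sub>R (?v (k - 1 - q) ** a ** U t q (- n - 1)))"
      unfolding row_def matrix_add_ldistrib scaleR_add_right sum.distrib scaleR_sum_right
      by (simp add: matrix_scalar_ac scalar_matrix_assoc[symmetric] mult.commute)
    also have "(\<Sum>q\<in>?R. ?\<omega> q *\<^sub>R (?v (k - 1 - q) ** a ** zmon (mat 1) q n))
      = (\<Sum>q\<in>?R. if q = n then ?\<omega> n *\<^sub>R (?v (k - 1 - n) ** a) else 0)"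
      by (intro sum.cong) (auto simp: zmon_def)
    also have "\<dots> = ?\<omega> n *\<^sub>R (?v (k - 1 - n) ** a)"
      \<comment> \<open>Also valid for \<open>n\<close> outside the range, where both sides
        vanish.\<close>
      using antidiag_weight_outside[of n k] by simp
    finally have S: "(\<Sum>q\<in>?R. ?\<omega> q *\<^sub>R (?v (k - 1 - q) ** a ** row c (U t) q n)) = \<dots>
        + ?h n *\<^sub>R (\<Sum>q\<in>?R. ?\<omega> q *\<^sub>R (?v (k - 1 - q) ** a ** U t q (- n - 1)))" .
    have "(row c (U t) 0 \<star> zmon a k) n = zmon a k n + ?h (n - k) *\<^sub>R (?v (k - 1 - n) ** a)"
      unfolding series_mult_zmon row_def matrix_add_rdistrib scalar_matrix_assoc[symmetric]
      by (auto simp: zmon_def algebra_simps)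
    moreover have "?h (n - k) = ?h n - ?\<omega> n"
      by (auto simp: antidiag_weight_def)
    moreover have "a ** row c (U t) k n = zmon a k n + ?h n *\<^sub>R (a ** U t k (- n - 1))"
      by (auto simp: row_def matrix_add_ldistrib matrix_scalar_ac scalar_matrix_assoc[symmetric] zmon_def)
    ultimately show ?thesis
      \<comment> \<open>the antidiagonal term \<open>q = n\<close> cancels the jump of the cutoff between \<open>n\<close> and \<open>n - k\<close>\<close>
      unfolding S W'_def by (simp add: scaleR_diff_right) (simp add: algebra_simps)
  qed
  ultimately show ?thesis
    unfolding wave_has_partial_def using rho_phase_has_partial[OF assms(1), of a t]
    by (intro exI[of _ W'] exI[of _ "zmon a k"]) auto
qed

section \<open>One left factor for the derivatives of all wave functions\<close>

definition derivative_factor :: "mat2 \<Rightarrow> (times \<Rightarrow> bmat) \<Rightarrow> int \<Rightarrow> times \<Rightarrow> series \<Rightarrow> bool" where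
  "derivative_factor a U k t A \<longleftrightarrow>
     (\<forall>n. A n \<noteq> 0 \<longrightarrow> min 0 k \<le> n \<and> n \<le> max 0 k) \<and>
     (k > 0 \<longrightarrow> A k = a) \<and> (k < 0 \<longrightarrow> A 0 = 0) \<and>
     (\<forall>c. wave_has_partial (\<lambda>s. Wave (row c (U s) 0) (rho_phase a s))
       (wave_lmult A (Wave (row c (U t) 0) (rho_phase a t))) k t)"

text \<open>Each row in the derivative formula is replaced by its multiple of \<open>row 0\<close>.
  For \<open>k > 0\<close> all \<open>q\<close> are below \<open>k\<close>, so only
  \<open>a ** P k\<close> reaches \<open>z^k\<close>; for \<open>k < 0\<close> all row indices are
  negative, so no constant term arises.\<close>

lemma derivative_factor_exists:
  assumes "k \<noteq> 0"
    and evolution: "\<And>j. has_partial (\<lambda>s. U s 0 j)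
      (a ** U t k j - U t 0 (j + k) ** a
        - (\<Sum>q\<in>antidiag_range k. antidiag_weight k q *\<^sub>R (U t 0 (k - 1 - q) ** a ** U t q j))) k t"
    and constraint: "\<And>i j. U t (i + 1) j = U t i (j + 1) + U t i 0 ** U t 0 j"
  shows "\<exists>A. derivative_factor a U k t A"
proof -
  let ?R = "antidiag_range k"
  obtain P where P: "\<And>i. row_factor (U t) i (P i)"
    using row_factor_exists[of "U t", OF constraint] by metis
  note fin = row_factor_finite[OF P]
  define C where "C q = (- antidiag_weight k q) *\<^sub>R (U t 0 (k - 1 - q) ** a)" for q
  define A where "A n = a ** P k n + (\<Sum>q\<in>?R. C q ** P q n)" for n
  have fin': "finite {n. B ** P i n \<noteq> 0}" for B :: mat2 and i
    by (rule finite_subset[OF _ fin[of i]]) auto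
  have rowP: "(P i \<star> row c (U t) 0) n = row c (U t) i n" for c i n
    using P[of i] by (simp add: row_factor_def)
  have A_row: "A \<star> row c (U t) 0 = (\<lambda>n. a ** row c (U t) k n
      - (\<Sum>q\<in>?R. antidiag_weight k q *\<^sub>R (U t 0 (k - 1 - q) ** a ** row c (U t) q n)))" for c
  proof
    fix n
    have "(A \<star> row c (U t) 0) n = a ** row c (U t) k n + (\<Sum>q\<in>?R. C q ** row c (U t) q n)"
      unfolding A_def
      by (simp add: series_mult_add_left series_mult_sum_left finite_support_sum fin fin'
          series_mult_const_left rowP)
    also have "(\<Sum>q\<in>?R. C q ** row c (U t) q n)
        = - (\<Sum>q\<in>?R. antidiag_weight k q *\<^sub>R (U t 0 (k - 1 - q) ** a ** row c (U t) q n))"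
      unfolding C_def scalar_matrix_assoc[symmetric] by (simp add: sum_negf)
    finally show "(A \<star> row c (U t) 0) n = a ** row c (U t) k n
      - (\<Sum>q\<in>?R. antidiag_weight k q *\<^sub>R (U t 0 (k - 1 - q) ** a ** row c (U t) q n))"
      by simp
  qed
  have supp: "A n = 0" if "P k n = 0" "\<And>q. q \<in> ?R \<Longrightarrow> P q n = 0" for n
    using that by (simp add: A_def)
  have "min 0 k \<le> n \<and> n \<le> max 0 k" if An: "A n \<noteq> 0" for n
  proof (rule ccontr)
    assume "\<not> ?thesis"
    then have far: "n < min 0 k \<or> n > max 0 k" by auto
    have "A n = 0"
    proof (rule supp)
      show "P k n = 0"
        using P[of k] far unfolding row_factor_def by (meson not_le)
    next
      fix q assume "q \<in> ?R"
      then have "n < min 0 q \<or> n > max 0 q"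
        using far by (auto simp: antidiag_range_def)
      then show "P q n = 0"
        using P[of q] unfolding row_factor_def by (meson not_le)
    qed
    with An show False by simp
  qed
  moreover have "A k = a" if "k > 0"
  proof -
    have "P q k = 0" if "q \<in> ?R" for q
    proof -
      have "k > max 0 q"
        using that \<open>k > 0\<close> by (auto simp: antidiag_range_def)
      then show ?thesis
        using P[of q] unfolding row_factor_def by (meson not_le)
    qed
    then show ?thesis
      using P[of k] that by (simp add: A_def row_factor_def)
  qed
  moreover have "A 0 = 0" if "k < 0"
  proof (rule supp)
    show "P k 0 = 0"
      using P[of k] that by (simp add: row_factor_def)
    show "P q 0 = 0" if "q \<in> ?R" for q
      using P[of q] that \<open>k < 0\<close> by (simp add: row_factor_def antidiag_range_def)
  qed
  moreover have "wave_has_partial (\<lambda>s. Wave (row c (U s) 0) (rho_phase a s))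
      (wave_lmult A (Wave (row c (U t) 0) (rho_phase a t))) k t" for c
    using wave_has_partial_row[OF assms(1) evolution, of c] by (simp add: wave_lmult_def A_row)
  ultimately show ?thesis
    unfolding derivative_factor_def by blast
qed

section \<open>Reading off the coefficients and conclusion\<close>

lemma zmon_sum_eq:
  assumes "inj_on f J" "finite J" "\<And>n. n \<notin> f ` J \<Longrightarrow> A n = 0"
  shows "(\<Sum>j\<in>J. zmon (A (f j)) (f j) n) = A n"
proof -
  have "(\<Sum>j\<in>J. zmon (A (f j)) (f j) n) = (\<Sum>m\<in>f ` J. zmon (A m) m n)"
    using assms by (simp add: sum.reindex)
  also have "\<dots> = A n"
    using assms by (auto simp: zmon_def)
  finally show ?thesis .
qed

theorem mainTheorem14:
  fixes a :: mat2 and U :: "times \<Rightarrow> bmat" and D :: "times set"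
  assumes a: "a \<noteq> 0" "semisimple_mat a"
    and D: "times_domain D"
    and evolution:
      "\<And>k t i j. k \<noteq> 0 \<Longrightarrow> t \<in> D \<Longrightarrow>
         has_partial (\<lambda>s. U s i j)
           (((a \<otimes>\<^sub>m Lambda k) \<odot> U t) i j - (U t \<odot> (a \<otimes>\<^sub>m Lambda (- k))) i j
             - (U t \<odot> (a \<otimes>\<^sub>m Omat k) \<odot> U t) i j) k t"
    and constraint:
      "\<And>t i j. t \<in> D \<Longrightarrow>
         ((mat 1 \<otimes>\<^sub>m Lambda 1) \<odot> U t) i j - (U t \<odot> (mat 1 \<otimes>\<^sub>m Lambda (- 1))) i j
           - (U t \<odot> (mat 1 \<otimes>\<^sub>m Omat 1) \<odot> U t) i j = 0"
  shows "\<forall>k::nat. k \<ge> 1 \<longrightarrow>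
    (\<exists>(A :: times \<Rightarrow> series) (Abar :: times \<Rightarrow> series)
       (c :: nat \<Rightarrow> times \<Rightarrow> mat2) (cbar :: nat \<Rightarrow> times \<Rightarrow> mat2).
      (\<forall>t\<in>D.
         A t = (\<lambda>n. zmon a (int k) n + (\<Sum>j = 1..k. zmon (c j t) (int k - int j) n)) \<and>
         Abar t = (\<lambda>n. \<Sum>j = 0..k - 1. zmon (cbar j t) (int j - int k) n) \<and>
         wave_has_partial (u0 a U) (wave_lmult (A t) (u0 a U t)) (int k) t \<and>
         wave_has_partial (u0bar a U) (wave_lmult (A t) (u0bar a U t)) (int k) t \<and>
         wave_has_partial (u0 a U) (wave_lmult (Abar t) (u0 a U t)) (- int k) t \<and>
         wave_has_partial (u0bar a U) (wave_lmult (Abar t) (u0bar a U t)) (- int k) t))"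
proof (intro allI impI)
  fix k :: nat
  assume k: "k \<ge> 1"
  let ?wave = "\<lambda>c s. Wave (row c (U s) 0) (rho_phase a s)"
  have factor: "\<exists>A. derivative_factor a U m t A" if "m \<noteq> 0" "t \<in> D" for m t
  proof (rule derivative_factor_exists)
    show "has_partial (\<lambda>s. U s 0 j)
      (a ** U t m j - U t 0 (j + m) ** a
        - (\<Sum>q\<in>antidiag_range m. antidiag_weight m q *\<^sub>R (U t 0 (m - 1 - q) ** a ** U t q j))) m t"
      for j
      using evolution[OF that, of 0 j]
      by (simp add: tensor_Lambda_bmult bmult_tensor_Lambda bmult_tensor_Omat_bmult)
    \<comment> \<open>\<open>Omat 1\<close> is the single unit \<open>E_{00}\<close>, so the
      quadratic term of the constraint is \<open>U t i 0 ** U t 0 j\<close>.\<close>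
    have "antidiag_range 1 = {0}"
      by (auto simp: antidiag_range_def)
    then show "U t (i + 1) j = U t i (j + 1) + U t i 0 ** U t 0 j" for i j
      using constraint[OF that(2), of i j]
      by (simp add: tensor_Lambda_bmult bmult_tensor_Lambda bmult_tensor_Omat_bmult
          antidiag_weight_def algebra_simps)
  qed fact
  have "int k \<noteq> 0" "- int k \<noteq> 0"
    using k by auto
  then obtain A Abar
    where A': "\<And>t. t \<in> D \<Longrightarrow> derivative_factor a U (int k) t (A t)"
      and Abar': "\<And>t. t \<in> D \<Longrightarrow> derivative_factor a U (- int k) t (Abar t)"
    using factor by metis
  note A = A'[unfolded derivative_factor_def] and Abar = Abar'[unfolded derivative_factor_def]
  have A_eq: "A t = (\<lambda>n. zmon a (int k) n + (\<Sum>j = 1..k. zmon (A t (int k - int j)) (int k - int j) n))"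
    if "t \<in> D" for t
  proof
    fix n
    \<comment> \<open>Starting at \<open>j = 0\<close> covers the whole support; that term is the
      leading \<open>a z^k\<close>, split off afterwards.\<close>
    have "(\<Sum>j = 0..k. zmon (A t (int k - int j)) (int k - int j) n) = A t n"
    proof (rule zmon_sum_eq)
      fix m assume m: "m \<notin> (\<lambda>j. int k - int j) ` {0..k}"
      have "\<not> (0 \<le> m \<and> m \<le> int k)"
      proof
        assume "0 \<le> m \<and> m \<le> int k"
        then have "m = int k - int (nat (int k - m))" "nat (int k - m) \<in> {0..k}" by auto
        with m show False by blast
      qed
      then show "A t m = 0" using A[OF that] by auto
    qed (auto simp: inj_on_def)
    then show "A t n = zmon a (int k) n + (\<Sum>j = 1..k. zmon (A t (int k - int j)) (int k - int j) n)"
      using A[OF that] k by (simp add: sum.atLeast_Suc_atMost)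
  qed
  have Abar_eq: "Abar t = (\<lambda>n. \<Sum>j = 0..k - 1. zmon (Abar t (int j - int k)) (int j - int k) n)"
    if "t \<in> D" for t
  proof
    fix n
    have "(\<Sum>j = 0..k - 1. zmon (Abar t (int j - int k)) (int j - int k) n) = Abar t n"
    proof (rule zmon_sum_eq)
      fix m assume m: "m \<notin> (\<lambda>j. int j - int k) ` {0..k - 1}"
      have "\<not> (- int k \<le> m \<and> m < 0)"
      proof
        assume "- int k \<le> m \<and> m < 0"
        then have "m = int (nat (m + int k)) - int k" "nat (m + int k) \<in> {0..k - 1}" by auto
        with m show False by blast
      qed
      \<comment> \<open>The support bound still admits \<open>m = 0\<close>, which its own clause
        excludes.\<close>
      then show "Abar t m = 0" using Abar[OF that] k by (cases "m = 0") force+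
    qed (auto simp: inj_on_def)
    then show "Abar t n = (\<Sum>j = 0..k - 1. zmon (Abar t (int j - int k)) (int j - int k) n)"
      by simp
  qed
  have waves: "u0 a U = ?wave (- 1)" "u0bar a U = ?wave 0"
    by (simp_all add: fun_eq_iff wave_eq_row)
  show "\<exists>(A :: times \<Rightarrow> series) (Abar :: times \<Rightarrow> series)
       (c :: nat \<Rightarrow> times \<Rightarrow> mat2) (cbar :: nat \<Rightarrow> times \<Rightarrow> mat2).
      (\<forall>t\<in>D.
         A t = (\<lambda>n. zmon a (int k) n + (\<Sum>j = 1..k. zmon (c j t) (int k - int j) n)) \<and>
         Abar t = (\<lambda>n. \<Sum>j = 0..k - 1. zmon (cbar j t) (int j - int k) n) \<and>
         wave_has_partial (u0 a U) (wave_lmult (A t) (u0 a U t)) (int k) t \<and>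
         wave_has_partial (u0bar a U) (wave_lmult (A t) (u0bar a U t)) (int k) t \<and>
         wave_has_partial (u0 a U) (wave_lmult (Abar t) (u0 a U t)) (- int k) t \<and>
         wave_has_partial (u0bar a U) (wave_lmult (Abar t) (u0bar a U t)) (- int k) t)"
    unfolding waves
    by (intro exI[of _ A] exI[of _ Abar] exI[of _ "\<lambda>j t. A t (int k - int j)"]
        exI[of _ "\<lambda>j t. Abar t (int j - int k)"] ballI conjI A_eq Abar_eq)
      (use A Abar in blast)+
qed

end
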